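(* Let $\mathcal{S}\subset\mathbb{R}^3$ be a surface, let $\phi:\mathbb{R}^3\to[0,\infty)$ be the unsigned distance field of $\mathcal{S}$, and let $U\subset\mathbb{R}^3$ be any open set on which $\phi$ is twice continuously differentiable. Let $\mathbf{v}:U\to\mathbb{R}^3$ be the distance vector field $\mathbf{v}(x,y,z)=-\phi(x,y,z)\,\nabla\phi(x,y,z)$. Then $\mathbf{v}$ is irrotational on $U$, i.e. it satisfies the zero-curl condition $\nabla\times\mathbf{v}=\mathbf{0}$ at every point of $U$.
   Context: A surface $\mathcal{S}\subset\mathbb{R}^3$ is a nonempty topologically closed subset of $\mathbb{R}^3$ that is a two-dimensional surface, possibly with boundary (it need not be watertight). The unsigned distance field of $\mathcal{S}$ is $\phi(\mathbf{x})=\min_{\hat{\mathbf{q}}\in\mathcal{S}}\|\hat{\mathbf{q}}-\mathbf{x}\|_2$. The distance vector field assigns to a point the displacement to its nearest point on $\mathcal{S}$; where $\phi$ is differentiable this displacement is expressed as $-\phi\nabla\phi$. For a differentiable vector field $\mathbf{v}=(v_x,v_y,v_z)$ on an open subset of $\mathbb{R}^3$, the curl is $\nabla\times\mathbf{v}=\left(\frac{\partial v_z}{\partial y}-\frac{\partial v_y}{\partial z},\ \frac{\partial v_x}{\partial z}-\frac{\partial v_z}{\partial x},\ \frac{\partial v_y}{\partial x}-\frac{\partial v_x}{\partial y}\right)$. *)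

theory Defs
  imports "HOL-Analysis.Analysis"
begin

definition half_plane :: "(real^2) set" where
  "half_plane = {y. 0 \<le> y $ 1}"

text \<open>A surface is an embedded topological 2-manifold, possibly with boundary; no smoothness
  is imposed. Interior points are covered because charts may avoid the line \<open>y $ 1 = 0\<close>.
  Hausdorffness and second countability are inherited from the ambient space.\<close>

definition surface :: "(real^3) set \<Rightarrow> bool" where
  "surface S \<longleftrightarrow> S \<noteq> {} \<and> closed S \<and>
     (\<forall>p\<in>S. \<exists>V W. p \<in> V \<and> openin (top_of_set S) V \<and>
        openin (top_of_set half_plane) W \<and> V homeomorphic W)"

definition unsigned_distance :: "(real^3) set \<Rightarrow> real^3 \<Rightarrow> real" where
  "unsigned_distance S x = infdist x S"

text \<open>For a surface the infimum in \<^const>\<open>infdist\<close> is a minimum.\<close>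

lemma unsigned_distance_is_minimum:
  assumes "surface S"
  shows "\<exists>q\<in>S. unsigned_distance S x = norm (q - x) \<and> (\<forall>r\<in>S. norm (q - x) \<le> norm (r - x))"
proof -
  have "closed S" "S \<noteq> {}"
    using assms by (auto simp: surface_def)
  then obtain q where q: "q \<in> S" "infdist x S = dist x q"
    using infdist_attains_inf by blast
  moreover have "dist x q \<le> dist x r" if "r \<in> S" for r
    using infdist_le[OF that, of x] q(2) by simp
  ultimately show ?thesis
    by (auto simp: unsigned_distance_def dist_norm norm_minus_commute)
qed

text \<open>The derivatives \<open>f'\<close> and \<open>f''\<close> are Frechet derivatives, valued in spaces of bounded
  linear maps. The set \<open>U\<close> is meant to be open.\<close>

definition twice_continuously_differentiable_on ::
    "('a::real_normed_vector \<Rightarrow> 'b::real_normed_vector) \<Rightarrow> 'a set \<Rightarrow> bool" where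
  "twice_continuously_differentiable_on f U \<longleftrightarrow>
     (\<exists>(f' :: 'a \<Rightarrow> 'a \<Rightarrow>\<^sub>L 'b) (f'' :: 'a \<Rightarrow> 'a \<Rightarrow>\<^sub>L 'a \<Rightarrow>\<^sub>L 'b).
        (\<forall>x\<in>U. (f has_derivative blinfun_apply (f' x)) (at x)) \<and>
        (\<forall>x\<in>U. (f' has_derivative blinfun_apply (f'' x)) (at x)) \<and>
        continuous_on U f'')"

text \<open>Partial derivative in the \<open>i\<close>-th coordinate; the value is arbitrary where it does not exist.\<close>

definition partial_deriv :: "'n::finite \<Rightarrow> (real^'n \<Rightarrow> real) \<Rightarrow> real^'n \<Rightarrow> real" where
  "partial_deriv i f x = deriv (\<lambda>t. f (x + t *\<^sub>R axis i 1)) 0"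

definition gradient :: "(real^'n::finite \<Rightarrow> real) \<Rightarrow> real^'n \<Rightarrow> real^'n" where
  "gradient f x = (\<chi> i. partial_deriv i f x)"

text \<open>The coordinates \<open>x, y, z\<close> are the components \<open>1, 2, 3\<close>.\<close>

definition curl :: "(real^3 \<Rightarrow> real^3) \<Rightarrow> real^3 \<Rightarrow> real^3" where
  "curl v p = vector
     [partial_deriv 2 (\<lambda>q. v q $ 3) p - partial_deriv 3 (\<lambda>q. v q $ 2) p,
      partial_deriv 3 (\<lambda>q. v q $ 1) p - partial_deriv 1 (\<lambda>q. v q $ 3) p,
      partial_deriv 1 (\<lambda>q. v q $ 2) p - partial_deriv 2 (\<lambda>q. v q $ 1) p]"

text \<open>Differentiability is part of the notion, so that the partial derivatives occurring in
  \<^const>\<open>curl\<close> exist and the equation is not about arbitrary values.\<close>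

definition irrotational_on :: "(real^3 \<Rightarrow> real^3) \<Rightarrow> (real^3) set \<Rightarrow> bool" where
  "irrotational_on v U \<longleftrightarrow> (\<forall>p\<in>U. v differentiable (at p) \<and> curl v p = 0)"

definition distance_vector_field :: "(real^3) set \<Rightarrow> real^3 \<Rightarrow> real^3" where
  "distance_vector_field S x = - unsigned_distance S x *\<^sub>R gradient (unsigned_distance S) x"

end

theory Submission
  imports Defs
begin

text \<open>Where \<open>\<phi>\<close> is \<open>C\<^sup>2\<close>, the field \<open>- \<phi> \<nabla>\<phi>\<close> is the gradient of \<open>- \<phi>\<^sup>2 / 2\<close>. Its Jacobian
  \<open>- \<nabla>\<phi> \<nabla>\<phi>\<^sup>T - \<phi> H\<close> is symmetric because the Hessian \<open>H\<close> is, and the curl measures exactly the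
  antisymmetric part of the Jacobian. Symmetry of \<open>H\<close> comes from estimating the symmetric second
  difference \<open>f (p + tu + tv) - f (p + tu) - f (p + tv) + f p\<close> by the mean value theorem, once
  along \<open>u\<close> and once along \<open>v\<close>.\<close>

text \<open>The second difference is the increment over \<open>[0, t]\<close> of
  \<open>s \<mapsto> f (p + s u + t v) - f (p + s u)\<close>. The mean value theorem turns it into
  \<open>t\<close> times a difference of two values of \<open>f'\<close> applied to
  \<open>u\<close>, and the linearization of \<open>f'\<close> at \<open>p\<close> evaluates both.
  Only the \<open>u\<close> direction is differentiated, so the bound is not symmetric in
  \<open>u\<close> and \<open>v\<close>.\<close>

lemma second_difference_estimate:
  fixes f :: "'a::real_normed_vector \<Rightarrow> real" and f' :: "'a \<Rightarrow> 'a \<Rightarrow>\<^sub>L real"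
  assumes U: "open U" "p \<in> U"
    and f: "\<And>x. x \<in> U \<Longrightarrow> (f has_derivative f' x) (at x)"
    and D: "(f' has_derivative D) (at p)"
    and "e > 0"
  shows "\<forall>\<^sub>F t in at_right 0.
    \<bar>f (p + t *\<^sub>R u + t *\<^sub>R v) - f (p + t *\<^sub>R u) - f (p + t *\<^sub>R v) + f p - t\<^sup>2 * D v u\<bar>
      \<le> 2 * e * (norm u + norm v) * norm u * t\<^sup>2"
proof -
  interpret D: bounded_linear D
    using D by (rule has_derivative_bounded_linear)
  obtain r where r: "r > 0" "ball p r \<subseteq> U"
    using U open_contains_ball by blast
  obtain d where d: "d > 0"
    and dD: "\<And>y. norm (y - p) < d \<Longrightarrow> norm (f' y - f' p - D (y - p)) \<le> e * norm (y - p)"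
    using D \<open>e > 0\<close> unfolding has_derivative_at_alt by meson
  define K where "K = norm u + norm v"
  have K: "K \<ge> 0" "norm u \<le> K" "norm v \<le> K"
    by (auto simp: K_def)
  \<comment> \<open>For \<open>t < \<delta>\<close> the parallelogram spanned at \<open>p\<close> by
    \<open>t u\<close> and \<open>t v\<close> stays inside \<open>U\<close> and inside the ball
    where \<open>dD\<close> applies. The \<open>+ 1\<close> covers \<open>K = 0\<close>.\<close>
  define \<delta> where "\<delta> = min r d / (K + 1)"
  have "\<delta> > 0"
    using r d K by (simp add: \<delta>_def)
  have est: "\<bar>f (p + t *\<^sub>R u + t *\<^sub>R v) - f (p + t *\<^sub>R u) - f (p + t *\<^sub>R v) + f p - t\<^sup>2 * D v u\<bar>
      \<le> 2 * e * K * norm u * t\<^sup>2" if t: "0 < t" "t < \<delta>" for t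
  proof -
    have tK: "t * K < min r d"
    proof -
      have "t * (K + 1) < min r d"
        using t K by (simp add: \<delta>_def pos_less_divide_eq)
      then show ?thesis
        using t by (simp add: distrib_left)
    qed
    have small: "norm (s *\<^sub>R u + c *\<^sub>R v) \<le> t * K" if "0 \<le> s" "s \<le> t" "0 \<le> c" "c \<le> t" for s c
    proof -
      have "norm (s *\<^sub>R u + c *\<^sub>R v) \<le> s * norm u + c * norm v"
        using norm_triangle_ineq[of "s *\<^sub>R u" "c *\<^sub>R v"] that by simp
      also have "\<dots> \<le> t * norm u + t * norm v"
        using that by (intro add_mono mult_right_mono) auto
      finally show ?thesis
        by (simp add: K_def distrib_left)
    qed
    have inU: "p + s *\<^sub>R u + c *\<^sub>R v \<in> U" if "0 \<le> s" "s \<le> t" "0 \<le> c" "c \<le> t" for s c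
    proof -
      have "dist p (p + h) = norm h" for h
        by (simp add: dist_norm)
      then have "dist p (p + s *\<^sub>R u + c *\<^sub>R v) < r"
        using small[OF that] tK by (simp add: add.assoc)
      then show ?thesis
        using r by auto
    qed
    have lin: "\<bar>f' (p + s *\<^sub>R u + c *\<^sub>R v) u - f' p u - D (s *\<^sub>R u + c *\<^sub>R v) u\<bar> \<le> e * (t * K) * norm u"
      if "0 \<le> s" "s \<le> t" "0 \<le> c" "c \<le> t" for s c
    proof -
      define h where "h = s *\<^sub>R u + c *\<^sub>R v"
      have h: "norm h \<le> t * K"
        using small[OF that] by (simp add: h_def)
      have "norm (f' (p + h) - f' p - D h) \<le> e * norm h"
        using dD[of "p + h"] h tK by simp
      also have "\<dots> \<le> e * (t * K)"
        using h \<open>e > 0\<close> by simp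
      finally have "norm (blinfun_apply (f' (p + h) - f' p - D h) u) \<le> e * (t * K) * norm u"
        using norm_blinfun[of "f' (p + h) - f' p - D h" u]
        by (meson mult_right_mono norm_ge_zero order_trans)
      then show ?thesis
        by (simp add: h_def blinfun.diff_left add.assoc)
    qed
    define g where "g s = f (p + s *\<^sub>R u + t *\<^sub>R v) - f (p + s *\<^sub>R u)" for s
    have g': "(g has_derivative
        (\<lambda>w. w * (f' (p + s *\<^sub>R u + t *\<^sub>R v) u - f' (p + s *\<^sub>R u) u))) (at s within {0..t})"
      if "s \<in> {0..t}" for s
    proof -
      \<comment> \<open>The cases \<open>c = t\<close> and \<open>c = 0\<close> are the two terms of
        \<open>g\<close>.\<close>
      have 1: "((\<lambda>s. f (p + s *\<^sub>R u + c *\<^sub>R v)) has_derivative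
          (\<lambda>w. w * f' (p + s *\<^sub>R u + c *\<^sub>R v) u)) (at s within {0..t})"
        if "0 \<le> c" "c \<le> t" for c
      proof -
        have "((\<lambda>s. f (p + s *\<^sub>R u + c *\<^sub>R v)) has_derivative
            (\<lambda>w. f' (p + s *\<^sub>R u + c *\<^sub>R v) (w *\<^sub>R u))) (at s within {0..t})"
          by (rule has_derivative_compose[OF _ f])
            (use that \<open>s \<in> {0..t}\<close> in \<open>auto intro!: inU derivative_eq_intros\<close>)
        then show ?thesis
          by (simp add: blinfun.scaleR_right)
      qed
      show ?thesis
        using has_derivative_diff[OF 1[of t] 1[of 0]] t
        by (simp add: g_def[abs_def] right_diff_distrib)
    qed
    have "\<exists>s\<in>{0<..<t}. g t - g 0 = (t - 0) * (f' (p + s *\<^sub>R u + t *\<^sub>R v) u - f' (p + s *\<^sub>R u) u)"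
      using t(1) g' by (intro mvt_simple) auto
    then obtain s where s: "s \<in> {0<..<t}"
      and gs: "g t - g 0 = (t - 0) * (f' (p + s *\<^sub>R u + t *\<^sub>R v) u - f' (p + s *\<^sub>R u) u)"
      by (rule bexE)
    have "f (p + t *\<^sub>R u + t *\<^sub>R v) - f (p + t *\<^sub>R u) - f (p + t *\<^sub>R v) + f p - t\<^sup>2 * D v u
        = t * (f' (p + s *\<^sub>R u + t *\<^sub>R v) u - f' (p + s *\<^sub>R u) u - t * D v u)"
      using gs by (simp add: g_def algebra_simps power2_eq_square)
    \<comment> \<open>In the difference of the two linearizations the unknown \<open>s\<close>
      cancels and \<open>t * D v u\<close> remains; the factor 2 counts the two errors.\<close>
    moreover have "\<bar>f' (p + s *\<^sub>R u + t *\<^sub>R v) u - f' (p + s *\<^sub>R u) u - t * D v u\<bar>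
        \<le> 2 * (e * (t * K) * norm u)"
    proof -
      have "D (s *\<^sub>R u + t *\<^sub>R v) u = D (s *\<^sub>R u) u + t * D v u"
        by (simp add: D.add D.scaleR blinfun.add_left blinfun.scaleR_left)
      with lin[of s t] lin[of s 0] s show ?thesis
        by simp
    qed
    then have "t * \<bar>f' (p + s *\<^sub>R u + t *\<^sub>R v) u - f' (p + s *\<^sub>R u) u - t * D v u\<bar>
        \<le> t * (2 * (e * (t * K) * norm u))"
      using t by simp
    ultimately show ?thesis
      using t by (simp add: abs_mult power2_eq_square mult_ac)
  qed
  show ?thesis
    unfolding eventually_at_right_field using est \<open>\<delta> > 0\<close> unfolding K_def by blast
qed

text \<open>Swapping \<open>u\<close> and \<open>v\<close> leaves the second difference unchanged,
  so it approximates both \<open>t\<^sup>2 * D v u\<close> and \<open>t\<^sup>2 * D u v\<close> up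
  to an arbitrarily small multiple of \<open>t\<^sup>2\<close>.\<close>

lemma second_derivative_symmetric:
  fixes f :: "'a::real_normed_vector \<Rightarrow> real" and f' :: "'a \<Rightarrow> 'a \<Rightarrow>\<^sub>L real"
  assumes "open U" "p \<in> U"
    and "\<And>x. x \<in> U \<Longrightarrow> (f has_derivative f' x) (at x)"
    and "(f' has_derivative D) (at p)"
  shows "D u v = D v u"
proof -
  \<comment> \<open>The sum of the error constants of the two estimates, with \<open>e\<close>
    factored out.\<close>
  define K where "K = 2 * (norm u + norm v) * (norm u + norm v)"
  have K: "K \<ge> 0"
    by (simp add: K_def)
  have bound: "\<bar>D u v - D v u\<bar> \<le> e * K" if "e > 0" for e
  proof -
    have est: "\<forall>\<^sub>F t in at_right 0.
        \<bar>f (p + t *\<^sub>R u + t *\<^sub>R v) - f (p + t *\<^sub>R u) - f (p + t *\<^sub>R v) + f p - t\<^sup>2 * D v u\<bar>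
          \<le> 2 * e * (norm u + norm v) * norm u * t\<^sup>2" for u v
      using assms that by (rule second_difference_estimate)
    have "\<forall>\<^sub>F t in at_right (0::real). \<bar>D u v - D v u\<bar> \<le> e * K"
      using est[of u v] est[of v u] eventually_at_right_less[of 0]
    proof eventually_elim
      case (elim t)
      have "t\<^sup>2 * \<bar>D u v - D v u\<bar> = \<bar>t\<^sup>2 * D u v - t\<^sup>2 * D v u\<bar>"
        unfolding right_diff_distrib[symmetric] abs_mult by simp
      also have "\<dots>
          \<le> 2 * e * (norm u + norm v) * norm u * t\<^sup>2 + 2 * e * (norm v + norm u) * norm v * t\<^sup>2"
        using elim(1,2) unfolding add.assoc add.commute[of "t *\<^sub>R v" "t *\<^sub>R u"] by linarith
      also have "\<dots> = t\<^sup>2 * (e * K)"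
        by (simp add: K_def algebra_simps)
      finally have "t\<^sup>2 * \<bar>D u v - D v u\<bar> \<le> t\<^sup>2 * (e * K)" .
      then show ?case
        using elim(3) by simp
    qed
    \<comment> \<open>The inequality does not mention \<open>t\<close>, and
      \<open>at_right 0\<close> is a nontrivial filter.\<close>
    then show ?thesis
      by simp
  qed
  have "\<bar>D u v - D v u\<bar> \<le> 0 + e" if "e > 0" for e
  proof -
    have "\<bar>D u v - D v u\<bar> \<le> e / (K + 1) * K"
      using K that by (intro bound) simp
    also have "\<dots> \<le> e"
      using K that by (simp add: field_simps)
    finally show ?thesis
      by simp
  qed
  then have "\<bar>D u v - D v u\<bar> \<le> 0"
    by (rule field_le_epsilon)
  then show ?thesis
    by simp
qed

text \<open>Chain rule along the coordinate line through \<open>x\<close>. This ties the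
  \<open>deriv\<close>-based definition to the Frechet derivative.\<close>

lemma partial_deriv_eq:
  assumes "(f has_derivative F) (at x)"
  shows "partial_deriv i f x = F (axis i 1)"
proof -
  interpret bounded_linear F
    using assms by (rule has_derivative_bounded_linear)
  have "((\<lambda>t. f (x + t *\<^sub>R axis i 1)) has_derivative (\<lambda>t. F (t *\<^sub>R axis i 1))) (at 0)"
    by (rule has_derivative_compose[where g = f])
      (use assms in \<open>auto intro!: derivative_eq_intros\<close>)
  then have "((\<lambda>t. f (x + t *\<^sub>R axis i 1)) has_field_derivative F (axis i 1)) (at 0)"
    by (rule has_derivative_imp_has_field_derivative) (simp add: scaleR)
  then show ?thesis
    unfolding partial_deriv_def by (rule DERIV_imp_deriv)
qed

theorem theorem3p1:
  fixes S U :: "(real^3) set"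
  assumes "surface S"
    and "open U"
    and "twice_continuously_differentiable_on (unsigned_distance S) U"
  shows "irrotational_on (distance_vector_field S) U"
proof -
  define \<phi> where "\<phi> = unsigned_distance S"
  obtain f' f'' where f': "\<And>x. x \<in> U \<Longrightarrow> (\<phi> has_derivative blinfun_apply (f' x)) (at x)"
    and f'': "\<And>x. x \<in> U \<Longrightarrow> (f' has_derivative blinfun_apply (f'' x)) (at x)"
    using assms(3) unfolding twice_continuously_differentiable_on_def \<phi>_def by blast
  define v where "v = distance_vector_field S"
  have v: "v q $ i = - \<phi> q * f' q (axis i 1)" if "q \<in> U" for q i
    using partial_deriv_eq[OF f'[OF that]]
    by (simp add: v_def distance_vector_field_def gradient_def \<phi>_def)
  \<comment> \<open>\<open>J p i\<close> is the \<open>i\<close>-th row of the Jacobian of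
    \<open>v\<close> at \<open>p\<close>, as given by the product rule.\<close>
  define J where
    "J p i h = - (\<phi> p * f'' p h (axis i 1)) - f' p h * f' p (axis i 1)" for p i h
  have J: "((\<lambda>q. v q $ i) has_derivative J p i) (at p)" if "p \<in> U" for p i
  proof -
    have 1: "((\<lambda>q. f' q (axis i 1)) has_derivative (\<lambda>h. f'' p h (axis i 1))) (at p)"
      using f''[OF that] by (rule bounded_linear.has_derivative[OF blinfun.bounded_linear_left])
    have "((\<lambda>q. - \<phi> q * f' q (axis i 1)) has_derivative J p i) (at p)"
      using has_derivative_mult[OF has_derivative_minus[OF f'[OF that]] 1]
      by (simp add: J_def[abs_def])
    \<comment> \<open>The product formula for \<open>v\<close> is known on \<open>U\<close> only;
      openness of \<open>U\<close> makes that enough for the derivative at \<open>p\<close>.\<close>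
    then show ?thesis
      by (rule has_derivative_transform_within_open[OF _ \<open>open U\<close> that]) (simp add: v)
  qed
  \<comment> \<open>The Hessian term is symmetric by the preceding lemma on second derivatives, the
    product of first derivatives by commutativity.\<close>
  have J_sym: "J p i (axis j 1) = J p j (axis i 1)" if "p \<in> U" for p i j
    using second_derivative_symmetric[OF \<open>open U\<close> that f' f''[OF that]] by (simp add: J_def)
  show ?thesis
    unfolding irrotational_on_def v_def[symmetric]
  proof (intro ballI conjI)
    fix p assume p: "p \<in> U"
    have "(\<lambda>q. v q \<bullet> b) differentiable (at p)" if "b \<in> Basis" for b
    proof -
      obtain i where "b = axis i 1"
        using \<open>b \<in> Basis\<close> by (auto simp: Basis_vec_def)
      then show ?thesis
        using J[OF p, of i] by (auto simp: inner_axis differentiable_def)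
    qed
    then show "v differentiable (at p)"
      unfolding differentiable_componentwise_within[of v] by blast
    \<comment> \<open>Each component of the curl is a difference of two such mixed partial
      derivatives.\<close>
    have "partial_deriv j (\<lambda>q. v q $ i) p = partial_deriv i (\<lambda>q. v q $ j) p" for i j
      unfolding partial_deriv_eq[OF J[OF p]] using p by (rule J_sym)
    then show "curl v p = 0"
      by (simp add: curl_def vec_eq_iff forall_3)
  qed
qed

end
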